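(* Suppose that the construction $\mathsf{C}$ is weakly $(S,T,S_{\mathsf{sim}},T_{\mathsf{sim}},\epsilon)$-indifferentiable with pre-computation from the construction $\mathsf{R}$ (quantum queries and quantum advice, no shared randomness, efficiency measured only by number of queries). Let $(\mathcal{P},\mathcal{E})$ be a security game with pre-computation in which the cryptosystem $\mathcal{P}$ makes $T_2$ queries to the private interface, and let $\mathcal{A}=(\mathcal{A}_0,\mathcal{A}_1)$ be an attacker in the $\mathsf{C}$ model of $\mathcal{P}$ with advice size $S$ and online query count $T_1$, where $T_1+T_2=T$. Then there is an attacker $\mathcal{A}'=(\mathcal{A}'_0,\mathcal{A}'_1)$ in the $\mathsf{R}$ model of $\mathcal{P}$ with advice size $S+S_{\mathsf{sim}}$ and online query count $T_{\mathsf{sim}}$ such that $$\Big|\Pr\big[\mathcal{E}[\mathcal{P}[\mathsf{C}^{\mathrm{priv}}],\mathcal{A}_1[\mathsf{C}^{\mathrm{pub}},\mathcal{A}_0[\mathsf{C}]]]=1\big]-\Pr\big[\mathcal{E}[\mathcal{P}[\mathsf{R}^{\mathrm{priv}}],\mathcal{A}'_1[\mathsf{R}^{\mathrm{pub}},\mathcal{A}'_0[\mathsf{R}]]]=1\big]\Big|\le\epsilon .$$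
   Context: All objects are families indexed by a security parameter $\lambda\in\mathbb{N}$, which is suppressed. Constructions. A construction $\mathsf{C}$ consists of a (randomly sampled) public interface $\mathsf{C}^{\mathrm{pub}}$ and a private interface $\mathsf{C}^{\mathrm{priv}}=\mathsf{C}^{\mathrm{priv}}[\mathsf{C}^{\mathrm{pub}}]$, an algorithm with oracle access to $\mathsf{C}^{\mathrm{pub}}$. Each interface is an oracle taking (qu)bits as input and returning (qu)bits. Access to $\mathsf{C}$ means access to both interfaces. $\mathsf{R}$ is another construction whose private interface syntactically matches that of $\mathsf{C}$ (same input/output types). Weak indifferentiability with pre-computation. $\mathsf{C}$ is weakly $(S,T,S_{\mathsf{sim}},T_{\mathsf{sim}},\epsilon)$-indifferentiable with pre-computation from $\mathsf{R}$ if for every pair of quantum algorithms $(\mathcal{D}_0,\mathcal{D}_1)$, where $\mathcal{D}_0$ is query- and computation-unbounded and outputs $S$ qubits, and $\mathcal{D}_1$ outputs a bit and makes at most $T$ queries in total to its two oracles, there exist simulators $(\mathcal{S}_0,\mathcal{S}_1)$, where - $\mathcal{S}_0$ is a query- and computation-unbounded quantum algorithm with access to $\mathsf{R}$ that outputs a joint state on two registers: $\mathcal{S}_0[\mathsf{R}]_{\mathcal{S}}$ of $S_{\mathsf{sim}}$ qubits (advice for $\mathcal{S}_1$) and $\mathcal{S}_0[\mathsf{R}]_{\mathcal{D}}$ of $S$ qubits (advice for $\mathcal{D}_1$); - $\mathcal{S}_1$ is a (possibly stateful) quantum algorithm that receives $\mathcal{S}_0[\mathsf{R}]_{\mathcal{S}}$,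 makes at most $T_{\mathsf{sim}}$ queries in total to $\mathsf{R}^{\mathrm{pub}}$, and answers $\mathcal{D}_1$'s queries to the public interface; such that, with $\epsilon=\epsilon(\lambda)$ negligible, $$\Big|\Pr\big[\mathcal{D}_1[\mathsf{C}^{\mathrm{priv}}[\mathsf{C}^{\mathrm{pub}}],\mathsf{C}^{\mathrm{pub}},\mathcal{D}_0[\mathsf{C}]]=1\big]-\Pr\big[\mathcal{D}_1[\mathsf{R}^{\mathrm{priv}},\mathcal{S}_1[\mathsf{R}^{\mathrm{pub}},\mathcal{S}_0[\mathsf{R}]_{\mathcal{S}}],\mathcal{S}_0[\mathsf{R}]_{\mathcal{D}}]=1\big]\Big|\le\epsilon .$$ $\mathcal{D}_1$ has access to $\mathcal{D}_0$ only through its $S$ output qubits. All parties are computationally unbounded; only queries and advice sizes are counted. Security game with pre-computation (described in the $\mathsf{C}$ model; the $\mathsf{R}$ model is identical with $\mathsf{R}$ in place of $\mathsf{C}$). - An offline adversary $\mathcal{A}_0$ is a computation- and query-unbounded quantum algorithm that interacts with $\mathsf{C}$ (both interfaces) and prepares an advice state; the number of its qubits is the advice size. The advice is given to $\mathcal{A}_1$. - An online adversary $\mathcal{A}_1$ is an interactive quantum algorithm that makes queries to $\mathsf{C}^{\mathrm{pub}}$ and interacts with $\mathcal{E}$ and $\mathcal{P}$; the number of its queries to the public interface is the online query count. - A cryptosystem $\mathcal{P}$ is an interactive quantum algorithm that makes $T_2$ queries to $\mathsf{C}^{\mathrm{priv}}$ and interacts with $\mathcal{E}$ and $\mathcal{A}_1$.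 - An environment $\mathcal{E}$ is an interactive quantum algorithm that interacts with $\mathcal{P}$ and $\mathcal{A}_1$ and outputs a bit at the end. "Interact" means exchanging (classical or quantum) messages back and forth for some number of rounds; the schedule, sizes and types of messages are fixed by the game. The pair $(\mathcal{P},\mathcal{E})$ is the same in the $\mathsf{C}$ and $\mathsf{R}$ models. *)

theory Defs
  imports
    "HOL-Probability.Probability_Measure"
    "HOL-Analysis.Infinite_Sum"
    "HOL-Library.Nat_Bijection"
    "Jordan_Normal_Form.Schur_Decomposition"
begin

section \<open>Qubits, states and local operations\<close>

text \<open>
  Qubits have names of some type \<^typ>\<open>'q\<close>. A computational basis state is the finite set of
  those qubits that are 1, and an operator on the joint space is given by its matrix entries between
  basis states. All but finitely many qubits are always in the state 0, so that no
  memory size has to be fixed in advance.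
\<close>

type_synonym 'q state = "'q set \<Rightarrow> 'q set \<Rightarrow> complex"

text \<open>
  The contents of a register, that is, of a list of qubits, is an index below \<^term>\<open>2 ^ length ws\<close>;
  the \<^term>\<open>j\<close>-th qubit of the list is the binary digit of weight \<^term>\<open>2 ^ j\<close>.
\<close>

definition contents :: "'q list \<Rightarrow> 'q set \<Rightarrow> nat" where
  "contents ws X = set_encode {j. j < length ws \<and> ws ! j \<in> X}"

definition overwrite :: "'q list \<Rightarrow> nat \<Rightarrow> 'q set \<Rightarrow> 'q set" where
  "overwrite ws a X = (X - set ws) \<union> {ws ! j | j. j < length ws \<and> j \<in> set_decode a}"

definition load :: "'q list \<Rightarrow> complex mat \<Rightarrow> 'q state" where
  "load ws M = (\<lambda>X Y. if X \<subseteq> set ws \<and> Y \<subseteq> set ws then M $$ (contents ws X, contents ws Y) else 0)"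

text \<open>Partial trace over all qubits except \<open>0, \<dots>, n - 1\<close>.\<close>

definition reduced :: "nat \<Rightarrow> nat state \<Rightarrow> complex mat" where
  "reduced n \<rho> = Matrix.mat (2 ^ n) (2 ^ n) (\<lambda>(a, b).
     \<Sum>\<^sub>\<infinity>Z \<in> {Z. finite Z \<and> Z \<inter> {..<n} = {}}. \<rho> (set_decode a \<union> Z) (set_decode b \<union> Z))"

definition trace_state :: "'q state \<Rightarrow> complex" where
  "trace_state \<rho> = (\<Sum>\<^sub>\<infinity>X \<in> {X. finite X}. \<rho> X X)"

text \<open>
  The tensor product of a linear map \<^term>\<open>\<Phi>\<close> on the operators of the register \<^term>\<open>ws\<close> with the
  identity on all other qubits: fixing the values of the other qubits selects a block of \<^term>\<open>\<rho>\<close>,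
  and \<^term>\<open>\<Phi>\<close> is applied to each block.
\<close>

definition on_register ::
    "(complex mat \<Rightarrow> complex mat) \<Rightarrow> 'q list \<Rightarrow> 'q state \<Rightarrow> 'q state" where
  "on_register \<Phi> ws \<rho> = (\<lambda>X Y.
     \<Phi> (Matrix.mat (2 ^ length ws) (2 ^ length ws)
          (\<lambda>(a, b). \<rho> (overwrite ws a X) (overwrite ws b Y)))
       $$ (contents ws X, contents ws Y))"

definition collapse :: "'q \<Rightarrow> bool \<Rightarrow> 'q state \<Rightarrow> 'q state" where
  "collapse w b \<rho> = (\<lambda>X Y. if (w \<in> X) = b \<and> (w \<in> Y) = b then \<rho> X Y else 0)"

definition unitary :: "nat \<Rightarrow> complex mat \<Rightarrow> bool" where
  "unitary N U \<longleftrightarrow> U \<in> carrier_mat N N \<and> mat_adjoint U * U = 1\<^sub>m N"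

definition quantum_channel :: "nat \<Rightarrow> (complex mat \<Rightarrow> complex mat) \<Rightarrow> bool" where
  "quantum_channel N \<Phi> \<longleftrightarrow> (\<exists>Ks. set Ks \<subseteq> carrier_mat N N \<and>
     foldr (+) (map (\<lambda>K. mat_adjoint K * K) Ks) (0\<^sub>m N N) = 1\<^sub>m N \<and>
     (\<forall>M \<in> carrier_mat N N.
        \<Phi> M = foldr (+) (map (\<lambda>K. K * M * mat_adjoint K) Ks) (0\<^sub>m N N)))"


section \<open>Quantum algorithms with oracle access\<close>

datatype interface = Priv | Pub

text \<open>
  A quantum algorithm is a finite tree of unitary gates, computational basis measurements (the two
  subtrees are the continuations after outcome 0 and outcome 1), oracle queries and final output
  bits. Memory is initially 0. Classical control is unrestricted, so which oracle is queried, and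
  when, may depend on earlier measurement outcomes. In an interactive algorithm, \<open>Yield\<close> ends a
  turn; the algorithm continues from there, with its memory intact, when it is next activated.
\<close>

datatype 'q prog =
    Return bool
  | Gate "complex mat" "'q list" "'q prog"
  | Measure 'q "'q prog" "'q prog"
  | Query interface "'q list" "'q prog"
  | Yield "'q prog"

text \<open>
  An oracle acts in place on a register of fixed width: it takes the qubits of the register as
  input and returns its output in the same register.
\<close>

primrec valid_prog :: "(interface \<Rightarrow> nat) \<Rightarrow> interface set \<Rightarrow> 'q prog \<Rightarrow> bool" where
  "valid_prog wd I (Return b) \<longleftrightarrow> True"
| "valid_prog wd I (Gate U ws p) \<longleftrightarrow>
     distinct ws \<and> unitary (2 ^ length ws) U \<and> valid_prog wd I p"
| "valid_prog wd I (Measure w p q) \<longleftrightarrow> valid_prog wd I p \<and> valid_prog wd I q"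
| "valid_prog wd I (Query i ws p) \<longleftrightarrow>
     i \<in> I \<and> distinct ws \<and> length ws = wd i \<and> valid_prog wd I p"
| "valid_prog wd I (Yield p) \<longleftrightarrow> valid_prog wd I p"

text \<open>The largest number of queries on any branch, over all turns.\<close>

primrec queries :: "'q prog \<Rightarrow> nat" where
  "queries (Return b) = 0"
| "queries (Gate U ws p) = queries p"
| "queries (Measure w p q) = max (queries p) (queries q)"
| "queries (Query i ws p) = Suc (queries p)"
| "queries (Yield p) = queries p"

text \<open>In its turn number \<^term>\<open>k\<close> (counting from 0) the algorithm only touches qubits in \<^term>\<open>V k\<close>.\<close>

primrec stays_in :: "'q prog \<Rightarrow> (nat \<Rightarrow> 'q set) \<Rightarrow> bool" where
  "stays_in (Return b) V \<longleftrightarrow> True"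
| "stays_in (Gate U ws p) V \<longleftrightarrow> set ws \<subseteq> V 0 \<and> stays_in p V"
| "stays_in (Measure w p q) V \<longleftrightarrow> w \<in> V 0 \<and> stays_in p V \<and> stays_in q V"
| "stays_in (Query i ws p) V \<longleftrightarrow> set ws \<subseteq> V 0 \<and> stays_in p V"
| "stays_in (Yield p) V \<longleftrightarrow> stays_in p (\<lambda>k. V (Suc k))"

text \<open>
  \<open>run oracle p \<rho> c\<close> is the unnormalised final state on the event that the output bit is \<^term>\<open>c\<close>.
\<close>

primrec run :: "(interface \<Rightarrow> complex mat \<Rightarrow> complex mat) \<Rightarrow> 'q prog \<Rightarrow> 'q state
    \<Rightarrow> bool \<Rightarrow> 'q state" where
  "run orac (Return b) \<rho> c = (if c = b then \<rho> else (\<lambda>X Y. 0))"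
| "run orac (Gate U ws p) \<rho> c = run orac p (on_register (\<lambda>M. U * M * mat_adjoint U) ws \<rho>) c"
| "run orac (Measure w p q) \<rho> c =
     (\<lambda>X Y. run orac p (collapse w False \<rho>) c X Y + run orac q (collapse w True \<rho>) c X Y)"
| "run orac (Query i ws p) \<rho> c = run orac p (on_register (orac i) ws \<rho>) c"
| "run orac (Yield p) \<rho> c = run orac p \<rho> c"

definition final_state ::
    "(interface \<Rightarrow> complex mat \<Rightarrow> complex mat) \<Rightarrow> 'q prog \<Rightarrow> 'q state \<Rightarrow> 'q state" where
  "final_state orac p \<rho> = (\<lambda>X Y. run orac p \<rho> False X Y + run orac p \<rho> True X Y)"

definition accept ::
    "(interface \<Rightarrow> complex mat \<Rightarrow> complex mat) \<Rightarrow> 'q prog \<Rightarrow> 'q state \<Rightarrow> real" where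
  "accept orac p \<rho> = Re (trace_state (run orac p \<rho> True))"


section \<open>Constructions\<close>

text \<open>
  The public interface is sampled once, by drawing a point of a probability space; offline and
  online phase of an experiment use the same sample.
\<close>

record 'w construction =
  sample :: "'w measure"
  priv_width :: nat
  pub_width :: nat
  pub :: "'w \<Rightarrow> complex mat \<Rightarrow> complex mat"
  priv :: "nat prog"

fun width :: "'w construction \<Rightarrow> interface \<Rightarrow> nat" where
  "width C Priv = priv_width C"
| "width C Pub = pub_width C"

definition valid_construction :: "'w construction \<Rightarrow> bool" where
  "valid_construction C \<longleftrightarrow>
     prob_space (sample C) \<and>
     (\<forall>\<omega> \<in> space (sample C). quantum_channel (2 ^ pub_width C) (pub C \<omega>)) \<and>
     (\<forall>M \<in> carrier_mat (2 ^ pub_width C) (2 ^ pub_width C).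
        \<forall>a < 2 ^ pub_width C. \<forall>b < 2 ^ pub_width C.
          (\<lambda>\<omega>. pub C \<omega> M $$ (a, b)) \<in> borel_measurable (sample C)) \<and>
     valid_prog (width C) {Pub} (priv C)"

text \<open>
  A private query runs the private algorithm with its argument on the qubits
  \<open>0, \<dots>, priv_width C - 1\<close> and fresh auxiliary qubits, which are discarded afterwards. Its own
  queries are answered by the public interface (\<^term>\<open>valid_prog\<close> excludes private ones).
\<close>

definition priv_channel :: "'w construction \<Rightarrow> 'w \<Rightarrow> complex mat \<Rightarrow> complex mat" where
  "priv_channel C \<omega> M =
     reduced (priv_width C) (final_state (\<lambda>_. pub C \<omega>) (priv C) (load [0..<priv_width C] M))"

fun oracle_of :: "'w construction \<Rightarrow> 'w \<Rightarrow> interface \<Rightarrow> complex mat \<Rightarrow> complex mat" where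
  "oracle_of C \<omega> Priv = priv_channel C \<omega>"
| "oracle_of C \<omega> Pub = pub C \<omega>"

text \<open>The state of the first \<^term>\<open>s\<close> qubits prepared by an offline algorithm.\<close>

definition advice :: "'w construction \<Rightarrow> 'w \<Rightarrow> nat \<Rightarrow> nat prog \<Rightarrow> complex mat" where
  "advice C \<omega> s p = reduced s (final_state (oracle_of C \<omega>) p (load [] (1\<^sub>m 1)))"

text \<open>
  Probability of output 1 when the online algorithm \<^term>\<open>p\<close> starts with the state prepared offline
  by \<^term>\<open>p0\<close> on its qubits \<^term>\<open>ws\<close> and 0 elsewhere.
\<close>

definition pr_output1 :: "'w construction \<Rightarrow> nat prog \<Rightarrow> 'q list \<Rightarrow> 'q prog \<Rightarrow> real" where
  "pr_output1 C p0 ws p =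
     (LINT \<omega>|sample C. accept (oracle_of C \<omega>) p (load ws (advice C \<omega> (length ws) p0)))"


section \<open>Weak indifferentiability with pre-computation\<close>

text \<open>Qubits of an interactive algorithm: its memory, and those shared with its communication partners.\<close>

datatype 'm iqubit = Own nat | Port 'm

text \<open>
  \<open>turn f k p\<close> performs the current turn of \<^term>\<open>p\<close>, with qubits named according to \<^term>\<open>f\<close>, and
  continues with \<^term>\<open>k\<close> applied to what remains of \<^term>\<open>p\<close>.
\<close>

primrec turn :: "('a \<Rightarrow> 'b) \<Rightarrow> ('a prog \<Rightarrow> 'b prog) \<Rightarrow> 'a prog \<Rightarrow> 'b prog" where
  "turn f k (Return b) = k (Return b)"
| "turn f k (Gate U ws p) = Gate U (map f ws) (turn f k p)"
| "turn f k (Measure w p q) = Measure (f w) (turn f k p) (turn f k q)"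
| "turn f k (Query i ws p) = Query i (map f ws) (turn f k p)"
| "turn f k (Yield p) = k p"

text \<open>
  \<open>simulate p s\<close> is \<^term>\<open>p\<close> with its public queries answered by \<^term>\<open>s\<close>, which takes one turn per
  query. In that turn, \<open>Port j\<close> is the \<^term>\<open>j\<close>-th qubit of the query register. Public queries of
  \<^term>\<open>s\<close>, and private queries of \<^term>\<open>p\<close>, remain.
\<close>

definition answer_qubit :: "'q list \<Rightarrow> nat iqubit \<Rightarrow> 'q + nat" where
  "answer_qubit ws w = (case w of Own i \<Rightarrow> Inr i | Port j \<Rightarrow> Inl (ws ! j))"

primrec simulate :: "'q prog \<Rightarrow> nat iqubit prog \<Rightarrow> ('q + nat) prog" where
  "simulate (Return b) s = Return b"
| "simulate (Gate U ws p) s = Gate U (map Inl ws) (simulate p s)"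
| "simulate (Measure w p q) s = Measure (Inl w) (simulate p s) (simulate q s)"
| "simulate (Query i ws p) s =
     (case i of
        Priv \<Rightarrow> Query Priv (map Inl ws) (simulate p s)
      | Pub \<Rightarrow> turn (answer_qubit ws) (simulate p) s)"
| "simulate (Yield p) s = Yield (simulate p s)"

text \<open>\<^term>\<open>n\<close> is the advice size, and the online distinguisher finds its advice on its first \<^term>\<open>n\<close> qubits.\<close>

definition real_experiment :: "'w construction \<Rightarrow> nat \<Rightarrow> nat prog \<Rightarrow> nat prog \<Rightarrow> real" where
  "real_experiment C n D0 D1 = pr_output1 C D0 [0..<n] D1"

text \<open>
  The offline simulator leaves the advice for the distinguisher on its qubits \<open>0, \<dots>, n - 1\<close> and
  the advice for the online simulator on its qubits \<open>n, \<dots>, n + m - 1\<close>.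
\<close>

definition ideal_experiment :: "'v construction \<Rightarrow> nat \<Rightarrow> nat \<Rightarrow> nat prog \<Rightarrow> nat iqubit prog
    \<Rightarrow> nat prog \<Rightarrow> real" where
  "ideal_experiment R n m S0 S1 D1 =
     pr_output1 R S0 (map Inl [0..<n] @ map Inr [0..<m]) (simulate D1 S1)"

definition negligible :: "(nat \<Rightarrow> real) \<Rightarrow> bool" where
  "negligible \<epsilon> \<longleftrightarrow> (\<forall>c::nat. \<forall>\<^sub>F l in sequentially. \<bar>\<epsilon> l\<bar> < 1 / real l ^ c)"

text \<open>All arguments are families indexed by the security parameter.\<close>

definition weakly_indifferentiable ::
    "(nat \<Rightarrow> 'w construction) \<Rightarrow> (nat \<Rightarrow> 'v construction) \<Rightarrow> (nat \<Rightarrow> nat) \<Rightarrow> (nat \<Rightarrow> nat)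
      \<Rightarrow> (nat \<Rightarrow> nat) \<Rightarrow> (nat \<Rightarrow> nat) \<Rightarrow> (nat \<Rightarrow> real) \<Rightarrow> bool" where
  "weakly_indifferentiable C R S T S_sim T_sim \<epsilon> \<longleftrightarrow>
     negligible \<epsilon> \<and>
     (\<forall>D0 D1.
        (\<forall>l. valid_prog (width (C l)) UNIV (D0 l)) \<and>
        (\<forall>l. valid_prog (width (C l)) UNIV (D1 l) \<and> queries (D1 l) \<le> T l) \<longrightarrow>
        (\<exists>S0 S1.
           (\<forall>l. valid_prog (width (R l)) UNIV (S0 l)) \<and>
           (\<forall>l. valid_prog (width (R l)) {Pub} (S1 l) \<and> queries (S1 l) \<le> T_sim l \<and>
                stays_in (S1 l) (\<lambda>_. range Own \<union> Port ` {..<pub_width (C l)})) \<and>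
           (\<forall>l. \<bar>real_experiment (C l) (S l) (D0 l) (D1 l)
                  - ideal_experiment (R l) (S l) (S_sim l) (S0 l) (S1 l) (D1 l)\<bar> \<le> \<epsilon> l)))"


section \<open>Security games with pre-computation\<close>

datatype party = Environment | Cryptosystem | Attacker

text \<open>A classical message is measured in the computational basis when it is sent.\<close>

record message =
  sender :: party
  receiver :: party
  qubits :: nat
  classical :: bool

text \<open>Qubit \<^term>\<open>j\<close> of message number \<^term>\<open>i\<close> is called \<open>Port (i, j)\<close> by all parties.\<close>

type_synonym party_prog = "(nat \<times> nat) iqubit prog"

record game =
  schedule :: "message list"
  cryptosystem :: party_prog
  environment :: party_prog

text \<open>
  A party has one turn per message that it sends, ending with the sending of that message. After the
  last message, the environment has one more turn to produce its output.
\<close>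

definition turns :: "message list \<Rightarrow> party \<Rightarrow> nat list" where
  "turns ms x = filter (\<lambda>t. sender (ms ! t) = x) [0..<length ms]
                  @ (if x = Environment then [length ms] else [])"

text \<open>
  In its turn number \<^term>\<open>k\<close> a party has access to its memory, to the messages received so far and
  to the initially 0 qubits of the message that it is about to send.
\<close>

definition accessible :: "message list \<Rightarrow> party \<Rightarrow> nat \<Rightarrow> (nat \<times> nat) iqubit set" where
  "accessible ms x k = range Own \<union>
     {Port (i, j) | i j. k < length (turns ms x) \<and> i < length ms \<and> j < qubits (ms ! i) \<and>
        (i = turns ms x ! k \<or> i < turns ms x ! k \<and> receiver (ms ! i) = x)}"

definition security_game :: "(interface \<Rightarrow> nat) \<Rightarrow> nat \<Rightarrow> game \<Rightarrow> bool" where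
  "security_game wd T2 G \<longleftrightarrow>
     valid_prog wd {Priv} (cryptosystem G) \<and> queries (cryptosystem G) \<le> T2 \<and>
     stays_in (cryptosystem G) (accessible (schedule G) Cryptosystem) \<and>
     valid_prog wd {} (environment G) \<and>
     stays_in (environment G) (accessible (schedule G) Environment)"

record attacker =
  advice_size :: nat
  offline :: "nat prog"
  online :: party_prog

definition valid_attacker ::
    "'w construction \<Rightarrow> game \<Rightarrow> nat \<Rightarrow> nat \<Rightarrow> attacker \<Rightarrow> bool" where
  "valid_attacker C G s T1 A \<longleftrightarrow>
     advice_size A = s \<and> valid_prog (width C) UNIV (offline A) \<and>
     valid_prog (width C) {Pub} (online A) \<and> queries (online A) \<le> T1 \<and>
     stays_in (online A) (accessible (schedule G) Attacker)"

definition game_qubit :: "party \<Rightarrow> (nat \<times> nat) iqubit \<Rightarrow> party \<times> nat + nat \<times> nat" where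
  "game_qubit x w = (case w of Own i \<Rightarrow> Inl (x, i) | Port m \<Rightarrow> Inr m)"

definition deliver :: "nat \<Rightarrow> message \<Rightarrow> (party \<times> nat + nat \<times> nat) prog
    \<Rightarrow> (party \<times> nat + nat \<times> nat) prog" where
  "deliver t m p =
     (if classical m then foldr (\<lambda>j q. Measure (Inr (t, j)) q q) [0..<qubits m] p else p)"

text \<open>
  The joint algorithm of the three parties from message number \<^term>\<open>t\<close> on. If the last turn of the
  environment does not produce an output, the output is 0.
\<close>

primrec play :: "message list \<Rightarrow> nat \<Rightarrow> (party \<Rightarrow> party_prog)
    \<Rightarrow> (party \<times> nat + nat \<times> nat) prog" where
  "play [] t \<sigma> =
     turn (game_qubit Environment)
       (\<lambda>p. Return (case p of Return b \<Rightarrow> b | _ \<Rightarrow> False)) (\<sigma> Environment)"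
| "play (m # ms) t \<sigma> =
     turn (game_qubit (sender m))
       (\<lambda>p. deliver t m (play ms (Suc t) (\<sigma>(sender m := p)))) (\<sigma> (sender m))"

definition game_prog :: "game \<Rightarrow> attacker \<Rightarrow> (party \<times> nat + nat \<times> nat) prog" where
  "game_prog G A = play (schedule G) 0
     (\<lambda>x. case x of Environment \<Rightarrow> environment G
                  | Cryptosystem \<Rightarrow> cryptosystem G
                  | Attacker \<Rightarrow> online A)"

text \<open>The online attacker receives the advice on its memory qubits \<open>Own 0, Own 1, \<dots>\<close>\<close>

definition game_pr :: "'w construction \<Rightarrow> game \<Rightarrow> attacker \<Rightarrow> real" where
  "game_pr C G A =
     pr_output1 C (offline A) (map (\<lambda>i. game_qubit Attacker (Own i)) [0..<advice_size A])
       (game_prog G A)"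

end

theory Submission
  imports Defs
begin

text \<open>
  The whole game in the \<open>C\<close> model, that is, environment, cryptosystem and online attacker played
  together, is one query algorithm with at most \<open>T1 + T2\<close> queries, and hence an online
  distinguisher; the simulator for it answers exactly the attacker's public queries. Grouping the
  simulator with the attacker instead of with the public interface gives the attacker in the \<open>R\<close>
  model. Both groupings yield the same joint program up to a bijective renaming of qubits, and such
  a renaming does not change acceptance probabilities.
\<close>

section \<open>Renaming qubits\<close>

definition relabel :: "('a \<Rightarrow> 'b) \<Rightarrow> 'a state \<Rightarrow> 'b state" where
  "relabel h \<rho> = (\<lambda>X Y. \<rho> (h -` X) (h -` Y))"

lemma contents_map: "contents (map h ws) X = contents ws (h -` X)"
  unfolding contents_def by (rule arg_cong[where f = set_encode]) auto

lemma vimage_overwrite_map: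
  assumes "inj h"
  shows "h -` overwrite (map h ws) a X = overwrite ws a (h -` X)"
  unfolding overwrite_def using assms by (auto simp: inj_def image_iff) (metis nth_map)+

lemma on_register_relabel:
  assumes "inj h"
  shows "on_register \<Phi> (map h ws) (relabel h \<rho>) = relabel h (on_register \<Phi> ws \<rho>)"
  unfolding on_register_def relabel_def
  by (simp add: contents_map vimage_overwrite_map[OF assms])

lemma collapse_relabel: "collapse (h w) b (relabel h \<rho>) = relabel h (collapse w b \<rho>)"
  unfolding collapse_def relabel_def by auto

text \<open>Surjectivity matters: preimages do not see a qubit outside the range of
  \<open>h\<close>, so the right-hand side could be nonzero where \<open>load\<close>
  vanishes.\<close>

lemma load_map:
  assumes "bij h"
  shows "load (map h ws) M = relabel h (load ws M)"
proof -
  have "X \<subseteq> h ` set ws \<longleftrightarrow> h -` X \<subseteq> set ws" for X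
    using image_mono[of "h -` X" "set ws" h] vimage_mono[of X "h ` set ws" h] assms
    by (auto simp: bij_def inj_vimage_image_eq surj_image_vimage_eq)
  then show ?thesis
    unfolding load_def relabel_def by (simp only: contents_map set_map)
qed

text \<open>Gates and oracles act on the contents of a register, which are indexed by positions in
  its list; hence the same \<open>orac\<close> serves both sides.\<close>

lemma run_relabel:
  assumes "inj h"
  shows "run orac (map_prog h p) (relabel h \<rho>) c = relabel h (run orac p \<rho> c)"
proof (induction p arbitrary: \<rho>)
  case (Measure w p q)
  \<comment> \<open>The collapses are commuted first, so that the induction hypotheses match; only
    then is \<open>relabel\<close> unfolded.\<close>
  then show ?case by (simp add: collapse_relabel) (simp add: relabel_def)
qed (auto simp: on_register_relabel[OF assms] relabel_def[of h "\<lambda>X Y. 0"])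

lemma trace_state_relabel:
  assumes "bij h"
  shows "trace_state (relabel h \<rho>) = trace_state \<rho>"
proof -
  have "bij_betw (\<lambda>X. h -` X) {X. finite X} {X. finite X}"
  proof (rule bij_betw_byWitness[where f' = "\<lambda>X. h ` X"])
    show "(\<lambda>X. h -` X) ` {X. finite X} \<subseteq> {X. finite X}"
      using assms by (auto intro: finite_vimageI simp: bij_def)
  qed (use assms in \<open>auto simp: bij_def inj_vimage_image_eq surj_image_vimage_eq\<close>)
  then show ?thesis
    unfolding trace_state_def relabel_def by (rule infsum_reindex_bij_betw)
qed

lemma accept_map_prog:
  assumes "bij h"
  shows "accept orac (map_prog h p) (load (map h ws) M) = accept orac p (load ws M)"
  using assms by (simp add: accept_def load_map run_relabel trace_state_relabel bij_is_inj)

text \<open>\<open>p0\<close> needs no renaming: its advice is a matrix indexed by positions in the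
  register.\<close>

lemma pr_output1_map_prog:
  assumes "bij h"
  shows "pr_output1 C p0 (map h ws) (map_prog h p) = pr_output1 C p0 ws p"
  using assms by (simp add: pr_output1_def accept_map_prog)

lemma queries_map_prog [simp]: "queries (map_prog h p) = queries p"
  by (induction p) auto

lemma valid_prog_map_prog:
  assumes "inj h"
  shows "valid_prog wd I (map_prog h p) \<longleftrightarrow> valid_prog wd I p"
  using assms by (induction p) (auto simp: distinct_map inj_on_subset[of h UNIV])

lemma stays_in_map_prog:
  assumes "stays_in p V" and "\<And>k. h ` V k \<subseteq> V' k"
  shows "stays_in (map_prog h p) V'"
  using assms
proof (induction p arbitrary: V V')
  case (Yield p)
  show ?case using Yield.IH[of "\<lambda>k. V (Suc k)" "\<lambda>k. V' (Suc k)"] Yield.prems by simp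
qed (auto, blast+)

section \<open>Bijections of qubit names with prescribed values\<close>

lemma bij_map_sum:
  assumes "bij f" and "bij g"
  shows "bij (map_sum f g)"
proof (rule o_bij)
  have "inv_into UNIV f \<circ> f = id" "inv_into UNIV g \<circ> g = id"
    "f \<circ> inv_into UNIV f = id" "g \<circ> inv_into UNIV g = id"
    using assms by (auto simp: bij_def surj_iff)
  then show "map_sum (inv_into UNIV f) (inv_into UNIV g) \<circ> map_sum f g = id"
    "map_sum f g \<circ> map_sum (inv_into UNIV f) (inv_into UNIV g) = id"
    by (simp_all add: fun_eq_iff sum.map_comp) (simp_all add: comp_def sum.map_ident)
qed

text \<open>The complements of \<open>F\<close> and of its image are both countably infinite, so
  enumerating them matches the remaining names.\<close>

lemma bij_extending:
  fixes f :: "'a \<Rightarrow> 'b"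
  assumes "countable (UNIV :: 'a set)" and "infinite (UNIV :: 'a set)"
    and "countable (UNIV :: 'b set)" and "infinite (UNIV :: 'b set)"
    and "finite F" and "inj_on f F"
  obtains h where "bij h" and "\<And>x. x \<in> F \<Longrightarrow> h x = f x"
proof -
  have a: "countable (- F)" "infinite (- F)"
    using assms by (auto intro: countable_subset simp: Compl_eq_Diff_UNIV)
  have b: "countable (- f ` F)" "infinite (- f ` F)"
    using assms by (auto intro: countable_subset simp: Compl_eq_Diff_UNIV)
  obtain u where u: "bij_betw u (- F) (- f ` F)"
    using bij_betw_trans[OF to_nat_on_infinite[OF a] bij_betw_from_nat_into[OF b]] by blast
  let ?h = "\<lambda>x. if x \<in> F then f x else u x"
  have "bij_betw ?h F (f ` F)"
    using assms(6) by (auto simp: bij_betw_def inj_on_def)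
  moreover have "bij_betw ?h (- F) (- f ` F)"
    using u by (rule bij_betw_cong[THEN iffD1, rotated]) auto
  ultimately have "bij_betw ?h (F \<union> - F) (f ` F \<union> - f ` F)"
    by (rule bij_betw_combine) auto
  then show ?thesis
    by (intro that[of ?h]) simp_all
qed

section \<open>Turns and simulated programs\<close>

lemma valid_prog_mono: "valid_prog wd I p \<Longrightarrow> I \<subseteq> J \<Longrightarrow> valid_prog wd J p"
  by (induction p) auto

lemma queries_no_interface: "valid_prog wd {} p \<Longrightarrow> queries p = 0"
  by (induction p) auto

lemma stays_in_UNIV: "stays_in p (\<lambda>_. UNIV)"
  by (induction p) auto

text \<open>Injectivity is required only on the reachable qubits \<open>W\<close>, since nothing is
  known about \<open>answer_qubit ws\<close> on ports beyond the register. \<open>W\<close> is the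
  same in all turns, so the remainder given to \<open>k\<close> inherits the invariant.\<close>

lemma valid_prog_turn:
  assumes "valid_prog wd I p" and "stays_in p (\<lambda>_. W)" and "inj_on f W"
    and "\<And>p'. valid_prog wd I p' \<Longrightarrow> stays_in p' (\<lambda>_. W) \<Longrightarrow> valid_prog wd I (k p')"
  shows "valid_prog wd I (turn f k p)"
  using assms by (induction p) (auto simp: distinct_map intro: inj_on_subset)

text \<open>\<open>c\<close> accounts for queries that the continuation adds on behalf of other
  programs.\<close>

lemma queries_turn:
  assumes "\<And>p'. queries (k p') \<le> queries p' + c"
  shows "queries (turn f k p) \<le> queries p + c"
proof (induction p)
  case (Return b)
  show ?case using assms[of "Return b"] by simp
next
  case (Yield p)
  show ?case using assms[of p] by simp
qed auto

text \<open>The turn is spliced in without its \<open>Yield\<close>, so \<open>V\<close> is not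
  shifted and only \<open>V 0\<close> matters for the renamed qubits.\<close>

lemma stays_in_turn:
  assumes "stays_in p (\<lambda>_. W)" and "f ` W \<subseteq> V 0"
    and "\<And>p'. stays_in p' (\<lambda>_. W) \<Longrightarrow> stays_in (k p') V"
  shows "stays_in (turn f k p) V"
  using assms(1) by (induction p) (use assms(2,3) in auto)

abbreviation oracle_qubits :: "nat \<Rightarrow> nat iqubit set" where
  "oracle_qubits n \<equiv> range Own \<union> Port ` {..<n}"

lemma inj_on_answer_qubit:
  assumes "distinct ws"
  shows "inj_on (answer_qubit ws) (oracle_qubits (length ws))"
  using assms by (auto simp: inj_on_def answer_qubit_def nth_eq_iff_index_eq)

lemma answer_qubit_map:
  assumes "w \<in> oracle_qubits (length ws)"
  shows "answer_qubit (map f ws) w = map_sum f id (answer_qubit ws w)"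
  using assms by (auto simp: answer_qubit_def)

text \<open>\<open>wd\<close> measures the register that \<open>p\<close> hands to the simulator,
  \<open>wd'\<close> the registers that the simulator hands on.\<close>

lemma valid_prog_simulate:
  assumes "valid_prog wd {Pub} p" and "valid_prog wd' {Pub} s"
    and "stays_in s (\<lambda>_. oracle_qubits (wd Pub))"
  shows "valid_prog wd' {Pub} (simulate p s)"
  using assms
proof (induction p arbitrary: s)
  case (Query i ws p)
  then show ?case
    using inj_on_answer_qubit[of ws]
    by (auto intro!: valid_prog_turn[where W = "oracle_qubits (wd Pub)"])
qed (auto simp: distinct_map)

text \<open>All queries of \<open>p\<close> are answered by successive turns of one stateful
  \<open>s\<close>, so each branch passes through \<open>s\<close> at most once and the bound is not
  multiplied by the number of queries of \<open>p\<close>.\<close>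

lemma queries_simulate:
  assumes "valid_prog wd {Pub} p"
  shows "queries (simulate p s) \<le> queries s"
  using assms
proof (induction p arbitrary: s)
  case (Query i ws p)
  then show ?case
    using queries_turn[of "simulate p" 0 "answer_qubit ws" s] by auto
qed auto

text \<open>Turns are counted by the \<open>Yield\<close>s of \<open>p\<close> alone; those of
  \<open>s\<close> disappear in the splicing.\<close>

lemma stays_in_simulate:
  assumes "valid_prog wd {Pub} p" and "stays_in p V"
    and "stays_in s (\<lambda>_. oracle_qubits (wd Pub))"
  shows "stays_in (simulate p s) (\<lambda>k. Inl ` V k \<union> range Inr)"
  using assms
proof (induction p arbitrary: s V)
  case (Query i ws p)
  have "answer_qubit ws ` oracle_qubits (wd Pub) \<subseteq> Inl ` V 0 \<union> range Inr"
    if "i = Pub"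
  proof -
    have "ws ! j \<in> V 0" if "j < wd Pub" for j
      using Query.prems that \<open>i = Pub\<close> nth_mem[of j ws] by auto
    then show ?thesis by (auto simp: answer_qubit_def)
  qed
  then show ?case
    using Query by (auto intro!: stays_in_turn[where W = "oracle_qubits (wd Pub)"])
next
  case (Yield p)
  show ?case using Yield.IH[of "\<lambda>k. V (Suc k)"] Yield.prems by simp
qed auto

section \<open>Renaming under simulation\<close>

lemma map_prog_turn:
  assumes "stays_in p (\<lambda>_. W)" and "\<And>w. w \<in> W \<Longrightarrow> f' w = h (f w)"
    and "\<And>p'. stays_in p' (\<lambda>_. W) \<Longrightarrow> map_prog h (k p') = k' p'"
  shows "map_prog h (turn f k p) = turn f' k' p"
  using assms(1) by (induction p) (use assms(2,3) in auto)

text \<open>Needed to undo, on the ideal side, the renaming that turns the game into a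
  distinguisher; the simulator's memory keeps its names.\<close>

lemma simulate_map_prog:
  assumes "valid_prog wd UNIV p" and "stays_in s (\<lambda>_. oracle_qubits (wd Pub))"
  shows "simulate (map_prog h p) s = map_prog (map_sum h id) (simulate p s)"
  using assms
proof (induction p arbitrary: s)
  case (Query i ws p)
  show ?case
  proof (cases i)
    case Pub
    then show ?thesis
      using Query
      by (auto intro!: map_prog_turn[where W = "oracle_qubits (wd Pub)", symmetric]
          simp: answer_qubit_map id_def)
  qed (use Query in simp)
qed auto

section \<open>Moving the simulator into the attacker\<close>

text \<open>
  \<^term>\<open>\<theta>\<close> places the memories of the original attacker (\<open>Inl\<close>) and of the simulator (\<open>Inr\<close>) side by
  side in the memory of the new attacker.
\<close>

definition merge_memory :: "(nat + nat \<Rightarrow> nat) \<Rightarrow> 'm iqubit + nat \<Rightarrow> 'm iqubit" where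
  "merge_memory \<theta> w = (case w of
     Inl (Own i) \<Rightarrow> Own (\<theta> (Inl i)) | Inl (Port m) \<Rightarrow> Port m | Inr j \<Rightarrow> Own (\<theta> (Inr j)))"

text \<open>Counterpart of \<open>merge_memory\<close> on the qubits of the whole game; the
  attacker's memory is moved by \<theta> to make room for the simulator's.\<close>

definition merge_game_memory ::
    "(nat + nat \<Rightarrow> nat) \<Rightarrow> (party \<times> nat + nat \<times> nat) + nat \<Rightarrow> party \<times> nat + nat \<times> nat" where
  "merge_game_memory \<theta> w = (case w of
     Inl (Inl (x, i)) \<Rightarrow> Inl (x, if x = Attacker then \<theta> (Inl i) else i)
   | Inl (Inr m) \<Rightarrow> Inr m
   | Inr j \<Rightarrow> Inl (Attacker, \<theta> (Inr j)))"

lemma inj_merge_memory: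
  assumes "inj \<theta>"
  shows "inj (merge_memory \<theta>)"
  using assms by (auto simp: inj_def merge_memory_def split: sum.splits iqubit.splits)

lemma bij_merge_game_memory:
  assumes "bij \<theta>"
  shows "bij (merge_game_memory \<theta>)"
proof (rule bijI)
  show "inj (merge_game_memory \<theta>)"
    using bij_is_inj[OF assms]
    by (auto simp: inj_def merge_game_memory_def split: sum.splits if_splits)
  show "surj (merge_game_memory \<theta>)"
    unfolding surj_def
  proof
    fix z :: "party \<times> nat + nat \<times> nat"
    show "\<exists>y. z = merge_game_memory \<theta> y"
    proof (cases "\<exists>k. z = Inl (Attacker, k)")
      case True
      then obtain k where z: "z = Inl (Attacker, k)" by blast
      obtain w where "k = \<theta> w" using bij_is_surj[OF assms] by (rule surjE)
      \<comment> \<open>The summand of \<open>w\<close> decides whether the preimage lies in the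
        attacker's or in the simulator's memory.\<close>
      then have "z = merge_game_memory \<theta> (map_sum (\<lambda>i. Inl (Attacker, i)) id w)"
        unfolding z by (cases w) (auto simp: merge_game_memory_def)
      then show ?thesis ..
    next
      case False
      then have "z = merge_game_memory \<theta> (Inl z)"
        by (auto simp: merge_game_memory_def split: sum.splits)
      then show ?thesis ..
    qed
  qed
qed

text \<open>Merging commutes with embedding into the game; this makes the two groupings of the
  simulator agree qubit by qubit.\<close>

lemma merge_game_qubit:
  "merge_game_memory \<theta> (Inl (game_qubit x w))
     = game_qubit x (if x = Attacker then merge_memory \<theta> (Inl w) else w)"
  "merge_game_memory \<theta> (Inr j) = game_qubit Attacker (merge_memory \<theta> (Inr j))"
  by (auto simp: merge_game_memory_def merge_memory_def game_qubit_def split: iqubit.splits)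

text \<open>Without public queries the simulator is not activated, so \<open>s\<close> reaches the
  continuation unchanged.\<close>

lemma simulate_turn_other:
  assumes "valid_prog wd {Priv} p" and "x \<noteq> Attacker"
    and "\<And>p'. valid_prog wd {Priv} p' \<Longrightarrow>
      map_prog (merge_game_memory \<theta>) (simulate (k p') s) = k' p'"
  shows "map_prog (merge_game_memory \<theta>) (simulate (turn (game_qubit x) k p) s)
    = turn (game_qubit x) k' p"
  using assms(1) by (induction p) (use assms(2,3) in \<open>auto simp: merge_game_qubit\<close>)

text \<open>One answered query, by induction on the simulator's turn: its \<open>Yield\<close> is
  removed by splicing, so on the right it does not end the attacker's turn.\<close>

lemma answer_turn_attacker:
  assumes "stays_in s (\<lambda>_. oracle_qubits (length ws))"
    and "\<And>s'. stays_in s' (\<lambda>_. oracle_qubits (length ws)) \<Longrightarrow>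
      map_prog (merge_game_memory \<theta>) (F s')
        = turn (game_qubit Attacker) k' (map_prog (merge_memory \<theta>) (F' s'))"
  shows "map_prog (merge_game_memory \<theta>) (turn (answer_qubit (map (game_qubit Attacker) ws)) F s)
    = turn (game_qubit Attacker) k' (map_prog (merge_memory \<theta>) (turn (answer_qubit ws) F' s))"
proof -
  have *: "merge_game_memory \<theta> (answer_qubit (map (game_qubit Attacker) ws) w)
      = game_qubit Attacker (merge_memory \<theta> (answer_qubit ws w))"
    if "w \<in> oracle_qubits (length ws)" for w
    using that by (auto simp: answer_qubit_def merge_game_qubit)
  from assms(1) show ?thesis
    by (induction s) (use * assms(2) in auto)
qed

text \<open>Each public query advances the simulator, so the hypothesis ranges over all
  \<open>s'\<close>; \<open>k'\<close> receives the remaining attacker and simulator as one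
  program.\<close>

lemma simulate_turn_attacker:
  assumes "valid_prog wd {Pub} p" and "stays_in s (\<lambda>_. oracle_qubits (wd Pub))"
    and "\<And>p' s'. valid_prog wd {Pub} p' \<Longrightarrow> stays_in s' (\<lambda>_. oracle_qubits (wd Pub)) \<Longrightarrow>
      map_prog (merge_game_memory \<theta>) (simulate (k p') s')
        = k' (map_prog (merge_memory \<theta>) (simulate p' s'))"
  shows "map_prog (merge_game_memory \<theta>) (simulate (turn (game_qubit Attacker) k p) s)
    = turn (game_qubit Attacker) k' (map_prog (merge_memory \<theta>) (simulate p s))"
  using assms(1,2)
proof (induction p arbitrary: s)
  case (Return b)
  \<comment> \<open>An attacker that has returned asks nothing more, so \<open>simulate\<close> may
    drop \<open>s\<close> here.\<close>
  then show ?case using assms(3)[of "Return b" s] by simp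
next
  case (Query i ws p)
  then show ?case by (auto intro!: answer_turn_attacker)
qed (use assms(3) in \<open>auto simp: merge_game_qubit\<close>)

lemma simulate_deliver:
  "map_prog (merge_game_memory \<theta>) (simulate (deliver t m p) s)
    = deliver t m (map_prog (merge_game_memory \<theta>) (simulate p s))"
proof -
  have "map_prog (merge_game_memory \<theta>) (simulate (foldr (\<lambda>j q. Measure (Inr (t, j)) q q) js p) s)
    = foldr (\<lambda>j q. Measure (Inr (t, j)) q q) js (map_prog (merge_game_memory \<theta>) (simulate p s))"
    for js
    by (induction js) (auto simp: merge_game_memory_def)
  then show ?thesis by (simp add: deliver_def)
qed

text \<open>Induction on the schedule: the simulator's state is carried along the joint program on
  the left and inside the attacker's remaining program on the right.\<close>

lemma simulate_play:
  assumes "valid_prog wd {Pub} (\<sigma> Attacker)" and "\<And>x. x \<noteq> Attacker \<Longrightarrow> valid_prog wd {Priv} (\<sigma> x)"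
    and "stays_in s (\<lambda>_. oracle_qubits (wd Pub))"
  shows "map_prog (merge_game_memory \<theta>) (simulate (play ms t \<sigma>) s)
    = play ms t (\<sigma>(Attacker := map_prog (merge_memory \<theta>) (simulate (\<sigma> Attacker) s)))"
  using assms
proof (induction ms arbitrary: t \<sigma> s)
  case Nil
  show ?case
    using Nil.prems(2)[of Environment] by (auto intro!: simulate_turn_other[where wd = wd])
next
  case (Cons m ms)
  let ?att = "\<lambda>p s. map_prog (merge_memory \<theta>) (simulate p s)"
  show ?case
  proof (cases "sender m = Attacker")
    case True
    have "map_prog (merge_game_memory \<theta>)
        (simulate (deliver t m (play ms (Suc t) (\<sigma>(Attacker := p')))) s')
      = deliver t m (play ms (Suc t) (\<sigma>(Attacker := ?att p' s')))"
      if "valid_prog wd {Pub} p'" and "stays_in s' (\<lambda>_. oracle_qubits (wd Pub))" for p' s'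
      using Cons.IH[of "\<sigma>(Attacker := p')" s' "Suc t"] Cons.prems that
      by (simp add: simulate_deliver fun_upd_def cong: if_cong)
    from simulate_turn_attacker[OF Cons.prems(1,3),
        where k' = "\<lambda>p. deliver t m (play ms (Suc t) (\<sigma>(Attacker := p)))", OF this]
    show ?thesis using True by (simp add: fun_upd_def cong: if_cong)
  next
    case False
    \<comment> \<open>The merged attacker stays fixed while the sender is updated; the two updates
      commute because the parties differ.\<close>
    have "map_prog (merge_game_memory \<theta>)
        (simulate (deliver t m (play ms (Suc t) (\<sigma>(sender m := p')))) s)
      = deliver t m (play ms (Suc t) (\<sigma>(Attacker := ?att (\<sigma> Attacker) s, sender m := p')))"
      if "valid_prog wd {Priv} p'" for p'
      using Cons.IH[of "\<sigma>(sender m := p')" s "Suc t"] Cons.prems that False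
      unfolding fun_upd_twist[OF False, of \<sigma> p', symmetric]
      by (simp add: simulate_deliver fun_upd_def cong: if_cong)
    from simulate_turn_other[OF Cons.prems(2)[OF False] False this]
    show ?thesis using False by (simp add: fun_upd_def cong: if_cong)
  qed
qed

section \<open>The game as a distinguisher\<close>

lemma inj_game_qubit: "inj (game_qubit x)"
  by (auto simp: inj_def game_qubit_def split: iqubit.splits)

lemma valid_prog_deliver:
  assumes "valid_prog wd I p"
  shows "valid_prog wd I (deliver t m p)"
proof -
  have "valid_prog wd I (foldr (\<lambda>j q. Measure (Inr (t, j)) q q) js p)" for js
    using assms by (induction js) auto
  with assms show ?thesis by (simp add: deliver_def)
qed

lemma queries_deliver [simp]: "queries (deliver t m p) = queries p"
proof -
  have "queries (foldr (\<lambda>j q. Measure (Inr (t, j)) q q) js p) = queries p" for js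
    by (induction js) auto
  then show ?thesis by (simp add: deliver_def)
qed

lemma valid_prog_play:
  assumes "\<And>x. valid_prog wd I (\<sigma> x)"
  shows "valid_prog wd I (play ms t \<sigma>)"
  using assms
proof (induction ms arbitrary: t \<sigma>)
  case Nil
  then show ?case
    by (auto intro!: valid_prog_turn[where W = UNIV] simp: stays_in_UNIV inj_game_qubit)
next
  case (Cons m ms)
  then show ?case
    by (auto intro!: valid_prog_turn[where W = UNIV] valid_prog_deliver
        simp: stays_in_UNIV inj_game_qubit)
qed

text \<open>Every branch passes through each party's program at most once.\<close>

lemma queries_play:
  "queries (play ms t \<sigma>)
    \<le> queries (\<sigma> Environment) + queries (\<sigma> Cryptosystem) + queries (\<sigma> Attacker)"
proof (induction ms arbitrary: t \<sigma>)
  case Nil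
  have "queries (play [] t \<sigma>) \<le> queries (\<sigma> Environment) + 0"
    unfolding play.simps by (rule queries_turn) simp
  then show ?case by simp
next
  case (Cons m ms)
  let ?x = "sender m"
  \<comment> \<open>The budget of the two parties that do not move.\<close>
  let ?c = "(if ?x = Environment then 0 else queries (\<sigma> Environment))
    + (if ?x = Cryptosystem then 0 else queries (\<sigma> Cryptosystem))
    + (if ?x = Attacker then 0 else queries (\<sigma> Attacker))"
  have "queries (play (m # ms) t \<sigma>) \<le> queries (\<sigma> ?x) + ?c"
    unfolding play.simps
  proof (rule queries_turn)
    fix p
    show "queries (deliver t m (play ms (Suc t) (\<sigma>(?x := p)))) \<le> queries p + ?c"
      using Cons.IH[of "Suc t" "\<sigma>(?x := p)"] by (cases ?x) (auto simp: fun_upd_def)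
  qed
  then show ?case by (cases ?x) auto
qed

section \<open>Choice of qubit names and the merged attacker\<close>

instance party :: countable
  by countable_datatype

text \<open>A distinguisher names qubits by numbers and expects its advice on the first
  \<open>n\<close>, whereas the game has it in the attacker's memory.\<close>

lemma obtain_distinguisher_names:
  obtains h :: "party \<times> nat + nat \<times> nat \<Rightarrow> nat"
  where "bij h" and "\<And>i. i < n \<Longrightarrow> h (Inl (Attacker, i)) = i"
proof -
  have inf: "infinite (UNIV :: (party \<times> nat + nat \<times> nat) set)"
    by (simp add: finite_prod)
  \<comment> \<open>On the advice qubits this function is the prescribed numbering.\<close>
  have "inj_on (\<lambda>z. snd (projl z)) ((\<lambda>i. Inl (Attacker, i)) ` {..<n})"
    by (auto simp: inj_on_def)
  from bij_extending[OF _ inf _ _ _ this]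
  obtain h :: "party \<times> nat + nat \<times> nat \<Rightarrow> nat" where
    "bij h" "\<And>x. x \<in> (\<lambda>i. Inl (Attacker, i)) ` {..<n} \<Longrightarrow> h x = snd (projl x)"
    by auto
  then show ?thesis by (intro that[of h]) auto
qed

text \<open>The order matches the offline simulator's output: the distinguisher's advice first, then
  that of the online simulator.\<close>

lemma obtain_memory_merge:
  obtains \<theta> :: "nat + nat \<Rightarrow> nat"
  where "bij \<theta>" and "\<And>i. i < n \<Longrightarrow> \<theta> (Inl i) = i" and "\<And>j. j < m \<Longrightarrow> \<theta> (Inr j) = n + j"
proof -
  have inf: "infinite (UNIV :: (nat + nat) set)"
    by simp
  have "inj_on (case_sum id ((+) n)) (Inl ` {..<n} \<union> Inr ` {..<m})"
    by (auto simp: inj_on_def)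
  from bij_extending[OF _ inf _ _ _ this]
  obtain \<theta> :: "nat + nat \<Rightarrow> nat" where
    "bij \<theta>" "\<And>x. x \<in> Inl ` {..<n} \<union> Inr ` {..<m} \<Longrightarrow> \<theta> x = case_sum id ((+) n) x"
    by auto
  then show ?thesis by (intro that[of \<theta>]) auto
qed

text \<open>\<open>n\<close> is the size of both pieces of advice together, which \<open>S0\<close>
  prepares as one register.\<close>

definition merged_attacker ::
    "(nat + nat \<Rightarrow> nat) \<Rightarrow> nat \<Rightarrow> nat prog \<Rightarrow> nat iqubit prog \<Rightarrow> attacker \<Rightarrow> attacker" where
  "merged_attacker \<theta> n S0 S1 A = \<lparr>advice_size = n, offline = S0,
     online = map_prog (merge_memory \<theta>) (simulate (online A) S1)\<rparr>"

lemma valid_merged_attacker: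
  assumes "valid_attacker C G s T1 A" and "inj \<theta>"
    and "valid_prog (width R) UNIV S0" and "valid_prog (width R) {Pub} S1" and "queries S1 \<le> T'"
    and "stays_in S1 (\<lambda>_. oracle_qubits (pub_width C))"
  shows "valid_attacker R G n T' (merged_attacker \<theta> n S0 S1 A)"
proof -
  have A: "valid_prog (width C) {Pub} (online A)"
    "stays_in (online A) (accessible (schedule G) Attacker)"
    using assms(1) by (auto simp: valid_attacker_def)
  have S1: "stays_in S1 (\<lambda>_. oracle_qubits (width C Pub))"
    using assms(6) by simp
  \<comment> \<open>Own memory is accessible in every turn and ports are fixed, so absorbing the
    simulator's memory is harmless.\<close>
  have "merge_memory \<theta> ` (Inl ` accessible (schedule G) Attacker k \<union> range Inr)
      \<subseteq> accessible (schedule G) Attacker k" for k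
    by (auto simp: merge_memory_def accessible_def)
  from stays_in_map_prog[OF stays_in_simulate[OF A S1] this]
  show ?thesis
    using assms(3,5) valid_prog_simulate[OF A(1) assms(4) S1] queries_simulate[OF A(1), of S1]
    by (simp add: valid_attacker_def merged_attacker_def valid_prog_map_prog
        inj_merge_memory[OF assms(2)])
qed

lemma valid_prog_game:
  assumes "security_game (width C) T2 G" and "valid_attacker C G s T1 A"
  shows "valid_prog (width C) UNIV (game_prog G A)"
proof -
  have "valid_prog (width C) UNIV (environment G)" "valid_prog (width C) UNIV (cryptosystem G)"
    "valid_prog (width C) UNIV (online A)"
    using assms valid_prog_mono[OF _ subset_UNIV]
    by (auto simp: security_game_def valid_attacker_def)
  then show ?thesis
    unfolding game_prog_def by (intro valid_prog_play) (simp split: party.split)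
qed

lemma queries_game:
  assumes "security_game (width C) T2 G" and "valid_attacker C G s T1 A"
  shows "queries (game_prog G A) \<le> T1 + T2"
proof -
  have "queries (game_prog G A)
      \<le> queries (environment G) + queries (cryptosystem G) + queries (online A)"
    unfolding game_prog_def by (rule order_trans[OF queries_play]) simp
  moreover have "queries (environment G) = 0"
    using assms(1) by (auto simp: security_game_def intro: queries_no_interface)
  ultimately show ?thesis
    using assms by (simp add: security_game_def valid_attacker_def)
qed

section \<open>The two experiments as games\<close>

lemma real_experiment_game:
  assumes "bij h" and "\<And>i. i < n \<Longrightarrow> h (Inl (Attacker, i)) = i" and "advice_size A = n"
  shows "real_experiment C n (offline A) (map_prog h (game_prog G A)) = game_pr C G A"
proof -
  have "[0..<n] = map h (map (\<lambda>i. game_qubit Attacker (Own i)) [0..<n])"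
    by (rule nth_equalityI) (auto simp: game_qubit_def assms(2))
  then show ?thesis
    unfolding real_experiment_def game_pr_def assms(3) by (metis pr_output1_map_prog[OF assms(1)])
qed

text \<open>Two renamings preserve the probability: \<open>h\<close> is undone around the
  simulation, then the simulator's memory is merged into the attacker's.\<close>

lemma ideal_experiment_game:
  assumes "bij h" and "\<And>i. i < n \<Longrightarrow> h (Inl (Attacker, i)) = i"
    and "bij \<theta>" and "\<And>i. i < n \<Longrightarrow> \<theta> (Inl i) = i" and "\<And>j. j < m \<Longrightarrow> \<theta> (Inr j) = n + j"
    and "security_game (width C) T2 G" and "valid_attacker C G n T1 A"
    and "stays_in S1 (\<lambda>_. oracle_qubits (pub_width C))"
  shows "ideal_experiment R n m S0 S1 (map_prog h (game_prog G A))
    = game_pr R G (merged_attacker \<theta> (n + m) S0 S1 A)"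
proof -
  \<comment> \<open>The advice register in the unrenamed qubits of game and simulator.\<close>
  let ?ws = "map (\<lambda>i. Inl (Inl (Attacker, i))) [0..<n] @ map Inr [0..<m]"
  have S1: "stays_in S1 (\<lambda>_. oracle_qubits (width C Pub))"
    using assms(8) by simp
  have bij_h: "bij (map_sum h id :: _ + nat \<Rightarrow> _)"
    by (rule bij_map_sum) (simp_all add: assms(1))
  have "map Inl [0..<n] @ map Inr [0..<m] = map (map_sum h id) ?ws"
    by (auto simp: assms(2))
  then have "ideal_experiment R n m S0 S1 (map_prog h (game_prog G A))
      = pr_output1 R S0 ?ws (simulate (game_prog G A) S1)"
    unfolding ideal_experiment_def simulate_map_prog[OF valid_prog_game[OF assms(6,7)] S1]
    by (simp only: pr_output1_map_prog[OF bij_h])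
  also have "\<dots> = pr_output1 R S0 (map (merge_game_memory \<theta>) ?ws)
      (map_prog (merge_game_memory \<theta>) (simulate (game_prog G A) S1))"
    by (simp only: pr_output1_map_prog[OF bij_merge_game_memory[OF assms(3)]])
  also have "map (merge_game_memory \<theta>) ?ws = map (\<lambda>i. game_qubit Attacker (Own i)) [0..<n + m]"
    by (rule nth_equalityI)
      (auto simp: game_qubit_def merge_game_memory_def nth_append assms(4,5))
  also have "map_prog (merge_game_memory \<theta>) (simulate (game_prog G A) S1)
      = game_prog G (merged_attacker \<theta> (n + m) S0 S1 A)"
  proof -
    let ?\<sigma> = "\<lambda>x. case x of Environment \<Rightarrow> environment G | Cryptosystem \<Rightarrow> cryptosystem G
      | Attacker \<Rightarrow> online A"
    \<comment> \<open>Weakening \<open>{}\<close> to \<open>{Priv}\<close> lets the environment be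
      treated like the cryptosystem.\<close>
    have "valid_prog (width C) {Priv} (?\<sigma> x)" if "x \<noteq> Attacker" for x
      using assms(6) that valid_prog_mono[of _ "{}" _ "{Priv}"]
      by (cases x) (auto simp: security_game_def)
    moreover have "valid_prog (width C) {Pub} (?\<sigma> Attacker)"
      using assms(7) by (simp add: valid_attacker_def)
    ultimately have "map_prog (merge_game_memory \<theta>) (simulate (play (schedule G) 0 ?\<sigma>) S1)
      = play (schedule G) 0 (?\<sigma>(Attacker := map_prog (merge_memory \<theta>) (simulate (?\<sigma> Attacker) S1)))"
      using S1 by (intro simulate_play[where wd = "width C"]) auto
    also have "?\<sigma>(Attacker := map_prog (merge_memory \<theta>) (simulate (?\<sigma> Attacker) S1))
      = (\<lambda>x. case x of Environment \<Rightarrow> environment G | Cryptosystem \<Rightarrow> cryptosystem G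
          | Attacker \<Rightarrow> online (merged_attacker \<theta> (n + m) S0 S1 A))"
      by (auto simp: merged_attacker_def split: party.split)
    finally show ?thesis unfolding game_prog_def .
  qed
  finally show ?thesis by (simp add: game_pr_def merged_attacker_def)
qed

theorem theorem4:
  fixes C :: "nat \<Rightarrow> 'w construction" and R :: "nat \<Rightarrow> 'v construction"
    and S T S_sim T_sim T1 T2 :: "nat \<Rightarrow> nat" and \<epsilon> :: "nat \<Rightarrow> real"
    and G :: "nat \<Rightarrow> game" and A :: "nat \<Rightarrow> attacker"
  assumes "\<And>l. valid_construction (C l)" and "\<And>l. valid_construction (R l)"
    and "\<And>l. priv_width (R l) = priv_width (C l)"
    and "weakly_indifferentiable C R S T S_sim T_sim \<epsilon>"
    and "\<And>l. security_game (width (C l)) (T2 l) (G l)"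
    and "\<And>l. valid_attacker (C l) (G l) (S l) (T1 l) (A l)"
    and "\<And>l. T1 l + T2 l = T l"
  shows "\<exists>A'. (\<forall>l. valid_attacker (R l) (G l) (S l + S_sim l) (T_sim l) (A' l)) \<and>
    (\<forall>l. \<bar>game_pr (C l) (G l) (A l) - game_pr (R l) (G l) (A' l)\<bar> \<le> \<epsilon> l)"
proof -
  \<comment> \<open>Names are chosen for every \<open>l\<close> at once, since indifferentiability
    speaks of families of distinguishers.\<close>
  have "\<exists>h :: party \<times> nat + nat \<times> nat \<Rightarrow> nat. bij h \<and> (\<forall>i < S l. h (Inl (Attacker, i)) = i)" for l
    by (metis obtain_distinguisher_names)
  then obtain h :: "nat \<Rightarrow> party \<times> nat + nat \<times> nat \<Rightarrow> nat"
    where h: "\<And>l. bij (h l)" "\<And>l i. i < S l \<Longrightarrow> h l (Inl (Attacker, i)) = i"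
    by metis
  have "\<exists>\<theta> :: nat + nat \<Rightarrow> nat. bij \<theta> \<and> (\<forall>i < S l. \<theta> (Inl i) = i)
      \<and> (\<forall>j < S_sim l. \<theta> (Inr j) = S l + j)" for l
    by (metis obtain_memory_merge)
  then obtain \<theta> :: "nat \<Rightarrow> nat + nat \<Rightarrow> nat"
    where \<theta>: "\<And>l. bij (\<theta> l)" "\<And>l i. i < S l \<Longrightarrow> \<theta> l (Inl i) = i"
      "\<And>l j. j < S_sim l \<Longrightarrow> \<theta> l (Inr j) = S l + j"
    by metis
  \<comment> \<open>The distinguisher is the whole game: at most \<open>T1\<close> public queries by
    the attacker and \<open>T2\<close> private ones by the cryptosystem.\<close>
  let ?D1 = "\<lambda>l. map_prog (h l) (game_prog (G l) (A l))"
  have "valid_prog (width (C l)) UNIV (offline (A l))" for l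
    using assms(6)[of l] by (simp add: valid_attacker_def)
  moreover have "valid_prog (width (C l)) UNIV (?D1 l)" for l
    using valid_prog_game[OF assms(5,6), of l] by (simp add: valid_prog_map_prog h(1) bij_is_inj)
  moreover have "queries (?D1 l) \<le> T l" for l
    using queries_game[OF assms(5,6), of l] assms(7)[of l] by simp
  ultimately obtain S0 S1 where sim:
    "\<And>l. valid_prog (width (R l)) UNIV (S0 l)" "\<And>l. valid_prog (width (R l)) {Pub} (S1 l)"
    "\<And>l. queries (S1 l) \<le> T_sim l" "\<And>l. stays_in (S1 l) (\<lambda>_. oracle_qubits (pub_width (C l)))"
    "\<And>l. \<bar>real_experiment (C l) (S l) (offline (A l)) (?D1 l)
        - ideal_experiment (R l) (S l) (S_sim l) (S0 l) (S1 l) (?D1 l)\<bar> \<le> \<epsilon> l"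
    using assms(4)[unfolded weakly_indifferentiable_def, THEN conjunct2, rule_format,
        of "\<lambda>l. offline (A l)" ?D1] by blast
  let ?A' = "\<lambda>l. merged_attacker (\<theta> l) (S l + S_sim l) (S0 l) (S1 l) (A l)"
  show ?thesis
  proof (intro exI[of _ ?A'] conjI allI)
    fix l
    show "valid_attacker (R l) (G l) (S l + S_sim l) (T_sim l) (?A' l)"
      using valid_merged_attacker[OF assms(6) bij_is_inj[OF \<theta>(1)] sim(1-4)] .
    have "real_experiment (C l) (S l) (offline (A l)) (?D1 l) = game_pr (C l) (G l) (A l)"
      using assms(6)[of l] h by (intro real_experiment_game) (auto simp: valid_attacker_def)
    moreover have "ideal_experiment (R l) (S l) (S_sim l) (S0 l) (S1 l) (?D1 l)
        = game_pr (R l) (G l) (?A' l)"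
      by (rule ideal_experiment_game[OF h(1)[of l] _ \<theta>(1)[of l] _ _ assms(5)[of l] assms(6)[of l]
            sim(4)[of l]]) (simp_all add: h \<theta>)
    ultimately show "\<bar>game_pr (C l) (G l) (A l) - game_pr (R l) (G l) (?A' l)\<bar> \<le> \<epsilon> l"
      using sim(5)[of l] by simp
  qed
qed

end
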